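(* Assume (A1) below and let $T>0$, $(x_0,y_0)\in\mathcal D$. For $(u(\cdot),v(\cdot))\in\mathcal U\times\mathcal V$ let $(x(\cdot),y(\cdot),z(\cdot))$ be the solution on $[0,T]$ of $$\dot x=f(x,y,u),\qquad \dot y=g(x,y,u),\qquad \dot z=\max(g(x,y,u),0)(1-v),\qquad (x(0),y(0),z(0))=(x_0,y_0,y_0).$$ Consider the two problems $$\mathcal P_1:\quad \inf_{(u(\cdot),v(\cdot))\in\mathcal U\times\mathcal V} z(T)\quad\text{under the state constraint } \mathcal C:\ z(t)-y(t)\ge 0,\ t\in[0,T],$$ $$\mathcal P_2:\quad \inf_{(u(\cdot),v(\cdot))\in\mathcal U\times\mathcal V} z(T)\quad\text{under the mixed constraint } \mathcal C_m:\ \max(y(t)-z(t),0)(1-v(t))+z(t)-y(t)\ge 0,\ \text{a.e. } t\in[0,T].$$ Then problems $\mathcal P_1$ and $\mathcal P_2$ are equivalent.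
   Context: Setting. Let $\mathcal D\subset\mathbb R^{n+1}$ be a domain and $U\subset\mathbb R^p$. Let $f:\mathcal D\times U\to\mathbb R^n$ and $g:\mathcal D\times U\to\mathbb R$ define the controlled system $$\dot x=f(x,y,u),\qquad \dot y=g(x,y,u),\qquad (x,y)\in\mathcal D,\ u\in U,$$ and assume that $\mathcal D$ is invariant for this system (solutions starting in $\mathcal D$ stay in $\mathcal D$, whatever the control). Assumption (A1): (i) $U$ is compact; (ii) $f$ and $g$ are $C^1$ on $\mathcal D\times U$; (iii) $f,g$ have linear growth: there is $C>0$ with $\|f(x,y,u)\|+|g(x,y,u)|\le C(1+\|x\|+|y|)$ for all $(x,y)\in\mathcal D$, $u\in U$. Notation. $\mathcal U$ is the set of measurable functions $u(\cdot):[0,T]\to U$ and $\mathcal V$ is the set of measurable functions $v(\cdot):[0,T]\to[0,1]$. Solutions are absolutely continuous functions satisfying the equations for a.e. $t$; under (A1) they exist on $[0,T]$ and are unique for each choice of controls and initial condition. *)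

theory Defs
  imports "HOL-Analysis.Analysis"
begin

text \<open>As the set \<^term>\<open>S\<close> need not be open (below it is a product of an open set and a compact
  set), being of class $C^1$ on it means having a $C^1$ extension to an open neighbourhood.\<close>

definition C1_on :: "('a::real_normed_vector \<Rightarrow> 'b::real_normed_vector) \<Rightarrow> 'a set \<Rightarrow> bool" where
  "C1_on F S \<longleftrightarrow> (\<exists>W G G'. open W \<and> S \<subseteq> W \<and> (\<forall>p\<in>S. G p = F p) \<and>
     (\<forall>p\<in>W. (G has_derivative blinfun_apply (G' p)) (at p)) \<and> continuous_on W G')"

text \<open>The set \<^term>\<open>P\<close> is a finite collection of intervals, given by their end points,
  with pairwise disjoint interiors. (The library constant \<open>absolutely_continuous\<close> is about
  measures.)\<close>

definition abs_cont_on :: "(real \<Rightarrow> 'a::real_normed_vector) \<Rightarrow> real \<Rightarrow> real \<Rightarrow> bool" where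
  "abs_cont_on h a b \<longleftrightarrow> (\<forall>\<epsilon>>0. \<exists>\<delta>>0. \<forall>P :: (real \<times> real) set.
     finite P \<and> (\<forall>(c, d)\<in>P. a \<le> c \<and> c \<le> d \<and> d \<le> b) \<and>
     disjoint_family_on (\<lambda>(c, d). {c<..<d}) P \<and> (\<Sum>(c, d)\<in>P. d - c) < \<delta>
     \<longrightarrow> (\<Sum>(c, d)\<in>P. norm (h d - h c)) < \<epsilon>)"

definition controls :: "real \<Rightarrow> 'a::topological_space set \<Rightarrow> (real \<Rightarrow> 'a) set" where
  "controls T U = {u. u \<in> borel_measurable (lebesgue_on {0..T}) \<and> (\<forall>t\<in>{0..T}. u t \<in> U)}"

definition xy_dynamics ::
  "(((real^'n) \<times> real) \<times> (real^'p) \<Rightarrow> real^'n) \<Rightarrow> (((real^'n) \<times> real) \<times> (real^'p) \<Rightarrow> real) \<Rightarrow> real \<Rightarrow>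
   (real \<Rightarrow> real^'p) \<Rightarrow> (real \<Rightarrow> real^'n) \<Rightarrow> (real \<Rightarrow> real) \<Rightarrow> bool" where
  "xy_dynamics f g T u x y \<longleftrightarrow> abs_cont_on x 0 T \<and> abs_cont_on y 0 T \<and>
     (AE t in lebesgue_on {0..T}.
        (x has_vector_derivative f ((x t, y t), u t)) (at t within {0..T}) \<and>
        (y has_vector_derivative g ((x t, y t), u t)) (at t within {0..T}))"

text \<open>The vector fields are only meaningful on \<^term>\<open>D \<times> U\<close>, so a solution is one
  that evolves in \<^term>\<open>D\<close>. Hence invariance says that it cannot reach a point outside
  \<^term>\<open>D\<close> in finite time; the values of \<^term>\<open>f\<close> and \<^term>\<open>g\<close> off \<^term>\<open>D \<times> U\<close> do not matter.\<close>

definition invariant_domain ::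
  "((real^'n) \<times> real) set \<Rightarrow> (real^'p) set \<Rightarrow> (((real^'n) \<times> real) \<times> (real^'p) \<Rightarrow> real^'n) \<Rightarrow>
   (((real^'n) \<times> real) \<times> (real^'p) \<Rightarrow> real) \<Rightarrow> bool" where
  "invariant_domain D U f g \<longleftrightarrow> (\<forall>\<tau>>0. \<forall>u\<in>controls \<tau> U. \<forall>x y.
     xy_dynamics f g \<tau> u x y \<and> (\<forall>t\<in>{0..<\<tau>}. (x t, y t) \<in> D) \<longrightarrow> (x \<tau>, y \<tau>) \<in> D)"

definition linear_growth ::
  "((real^'n) \<times> real) set \<Rightarrow> (real^'p) set \<Rightarrow> (((real^'n) \<times> real) \<times> (real^'p) \<Rightarrow> real^'n) \<Rightarrow>
   (((real^'n) \<times> real) \<times> (real^'p) \<Rightarrow> real) \<Rightarrow> bool" where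
  "linear_growth D U f g \<longleftrightarrow> (\<exists>C>0. \<forall>(x, y)\<in>D. \<forall>u\<in>U.
     norm (f ((x, y), u)) + \<bar>g ((x, y), u)\<bar> \<le> C * (1 + norm x + \<bar>y\<bar>))"

definition extended_solution ::
  "((real^'n) \<times> real) set \<Rightarrow> (((real^'n) \<times> real) \<times> (real^'p) \<Rightarrow> real^'n) \<Rightarrow>
   (((real^'n) \<times> real) \<times> (real^'p) \<Rightarrow> real) \<Rightarrow> real \<Rightarrow> real^'n \<Rightarrow> real \<Rightarrow> (real \<Rightarrow> real^'p) \<Rightarrow> (real \<Rightarrow> real) \<Rightarrow>
   (real \<Rightarrow> real^'n) \<Rightarrow> (real \<Rightarrow> real) \<Rightarrow> (real \<Rightarrow> real) \<Rightarrow> bool" where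
  "extended_solution D f g T x0 y0 u v x y z \<longleftrightarrow>
     (\<forall>t\<in>{0..T}. (x t, y t) \<in> D) \<and> xy_dynamics f g T u x y \<and> abs_cont_on z 0 T \<and>
     (AE t in lebesgue_on {0..T}.
        (z has_vector_derivative max (g ((x t, y t), u t)) 0 * (1 - v t)) (at t within {0..T})) \<and>
     x 0 = x0 \<and> y 0 = y0 \<and> z 0 = y0"

definition state_constraint :: "real \<Rightarrow> (real \<Rightarrow> real) \<Rightarrow> (real \<Rightarrow> real) \<Rightarrow> bool" where
  "state_constraint T y z \<longleftrightarrow> (\<forall>t\<in>{0..T}. z t - y t \<ge> 0)"

definition mixed_constraint ::
  "real \<Rightarrow> (real \<Rightarrow> real) \<Rightarrow> (real \<Rightarrow> real) \<Rightarrow> (real \<Rightarrow> real) \<Rightarrow> bool" where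
  "mixed_constraint T v y z \<longleftrightarrow>
     (AE t in lebesgue_on {0..T}. max (y t - z t) 0 * (1 - v t) + z t - y t \<ge> 0)"

text \<open>A minimization problem is given by its feasible set and its cost. For the optimal control
  problems below the feasible points are the admissible processes, i.e. the controls $(u,v)$
  together with the associated solution $(x,y,z)$.\<close>

record 'a min_problem =
  feasible :: "'a set"
  cost :: "'a \<Rightarrow> real"

definition min_value :: "'a min_problem \<Rightarrow> ereal" where
  "min_value P = (INF w\<in>feasible P. ereal (cost P w))"

definition minimizers :: "'a min_problem \<Rightarrow> 'a set" where
  "minimizers P = {w \<in> feasible P. ereal (cost P w) = min_value P}"

definition equivalent_problems :: "'a min_problem \<Rightarrow> 'a min_problem \<Rightarrow> bool" where
  "equivalent_problems P Q \<longleftrightarrow> feasible P = feasible Q \<and> (\<forall>w\<in>feasible P. cost P w = cost Q w) \<and>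
     min_value P = min_value Q \<and> minimizers P = minimizers Q"

type_synonym ('n, 'p) process =
  "(real \<Rightarrow> real^'p) \<times> (real \<Rightarrow> real) \<times> (real \<Rightarrow> real^'n) \<times> (real \<Rightarrow> real) \<times> (real \<Rightarrow> real)"

definition problem1 ::
  "((real^'n) \<times> real) set \<Rightarrow> (real^'p) set \<Rightarrow> (((real^'n) \<times> real) \<times> (real^'p) \<Rightarrow> real^'n) \<Rightarrow>
   (((real^'n) \<times> real) \<times> (real^'p) \<Rightarrow> real) \<Rightarrow> real \<Rightarrow> real^'n \<Rightarrow> real \<Rightarrow> ('n, 'p) process min_problem" where
  "problem1 D U f g T x0 y0 =
     \<lparr>feasible = {(u, v, x, y, z). u \<in> controls T U \<and> v \<in> controls T {0..1} \<and>
        extended_solution D f g T x0 y0 u v x y z \<and> state_constraint T y z},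
      cost = (\<lambda>(u, v, x, y, z). z T)\<rparr>"

definition problem2 ::
  "((real^'n) \<times> real) set \<Rightarrow> (real^'p) set \<Rightarrow> (((real^'n) \<times> real) \<times> (real^'p) \<Rightarrow> real^'n) \<Rightarrow>
   (((real^'n) \<times> real) \<times> (real^'p) \<Rightarrow> real) \<Rightarrow> real \<Rightarrow> real^'n \<Rightarrow> real \<Rightarrow> ('n, 'p) process min_problem" where
  "problem2 D U f g T x0 y0 =
     \<lparr>feasible = {(u, v, x, y, z). u \<in> controls T U \<and> v \<in> controls T {0..1} \<and>
        extended_solution D f g T x0 y0 u v x y z \<and> mixed_constraint T v y z},
      cost = (\<lambda>(u, v, x, y, z). z T)\<rparr>"

end

theory Submission
  imports Defs
begin

text \<open>The two problems have the same admissible processes. Where \<open>z \<ge> y\<close>, the mixed constraint is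
  automatic. Where \<open>y > z\<close>, it reads \<open>(y - z) v \<le> 0\<close> and hence forces \<open>v = 0\<close>, so that
  \<open>z' = max(g, 0) \<ge> y'\<close> almost everywhere: \<open>y - z\<close> starts at \<open>0\<close> and cannot increase while it is
  positive, so it never becomes positive.\<close>

section \<open>Basic properties of absolutely continuous functions\<close>

lemma abs_cont_on_subinterval:
  assumes "abs_cont_on h a b" "a \<le> c" "d \<le> b"
  shows "abs_cont_on h c d"
  unfolding abs_cont_on_def
proof (intro allI impI)
  fix e :: real assume "e > 0"
  then obtain \<delta> where "\<delta> > 0" and \<delta>: "\<And>P :: (real \<times> real) set.
     finite P \<and> (\<forall>(c, d)\<in>P. a \<le> c \<and> c \<le> d \<and> d \<le> b) \<and>
     disjoint_family_on (\<lambda>(c, d). {c<..<d}) P \<and> (\<Sum>(c, d)\<in>P. d - c) < \<delta>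
     \<Longrightarrow> (\<Sum>(c, d)\<in>P. norm (h d - h c)) < e"
    using assms(1) unfolding abs_cont_on_def by meson
  have "(\<Sum>(c, d)\<in>P. norm (h d - h c)) < e"
    if "finite P \<and> (\<forall>(p, q)\<in>P. c \<le> p \<and> p \<le> q \<and> q \<le> d) \<and>
      disjoint_family_on (\<lambda>(c, d). {c<..<d}) P \<and> (\<Sum>(c, d)\<in>P. d - c) < \<delta>" for P
    using that assms(2,3) by (intro \<delta>) fastforce
  with \<open>\<delta> > 0\<close> show "\<exists>\<delta>>0. \<forall>P. finite P \<and> (\<forall>(p, q)\<in>P. c \<le> p \<and> p \<le> q \<and> q \<le> d) \<and>
      disjoint_family_on (\<lambda>(c, d). {c<..<d}) P \<and> (\<Sum>(c, d)\<in>P. d - c) < \<delta> \<longrightarrow>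
      (\<Sum>(c, d)\<in>P. norm (h d - h c)) < e"
    by blast
qed

lemma abs_cont_on_diff:
  assumes "abs_cont_on h a b" "abs_cont_on k a b"
  shows "abs_cont_on (\<lambda>t. h t - k t) a b"
  unfolding abs_cont_on_def
proof (intro allI impI)
  fix e :: real assume "e > 0"
  then have e2: "e / 2 > 0" by simp
  obtain \<delta>1 where "\<delta>1 > 0" and \<delta>1: "\<And>P :: (real \<times> real) set.
     finite P \<and> (\<forall>(c, d)\<in>P. a \<le> c \<and> c \<le> d \<and> d \<le> b) \<and>
     disjoint_family_on (\<lambda>(c, d). {c<..<d}) P \<and> (\<Sum>(c, d)\<in>P. d - c) < \<delta>1
     \<Longrightarrow> (\<Sum>(c, d)\<in>P. norm (h d - h c)) < e / 2"
    using assms(1) e2 unfolding abs_cont_on_def by meson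
  obtain \<delta>2 where "\<delta>2 > 0" and \<delta>2: "\<And>P :: (real \<times> real) set.
     finite P \<and> (\<forall>(c, d)\<in>P. a \<le> c \<and> c \<le> d \<and> d \<le> b) \<and>
     disjoint_family_on (\<lambda>(c, d). {c<..<d}) P \<and> (\<Sum>(c, d)\<in>P. d - c) < \<delta>2
     \<Longrightarrow> (\<Sum>(c, d)\<in>P. norm (k d - k c)) < e / 2"
    using assms(2) e2 unfolding abs_cont_on_def by meson
  have "(\<Sum>(c, d)\<in>P. norm (h d - k d - (h c - k c))) < e"
    if P: "finite P \<and> (\<forall>(c, d)\<in>P. a \<le> c \<and> c \<le> d \<and> d \<le> b) \<and>
      disjoint_family_on (\<lambda>(c, d). {c<..<d}) P \<and> (\<Sum>(c, d)\<in>P. d - c) < min \<delta>1 \<delta>2" for P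
  proof -
    have "(\<Sum>(c, d)\<in>P. norm (h d - k d - (h c - k c)))
        \<le> (\<Sum>(c, d)\<in>P. norm (h d - h c) + norm (k d - k c))"
    proof (intro sum_mono, clarify)
      fix c d
      have "norm (h d - k d - (h c - k c)) = norm ((h d - h c) - (k d - k c))"
        by (simp add: algebra_simps)
      also have "\<dots> \<le> norm (h d - h c) + norm (k d - k c)"
        by (rule norm_triangle_ineq4)
      finally show "norm (h d - k d - (h c - k c)) \<le> norm (h d - h c) + norm (k d - k c)" .
    qed
    also have "\<dots> = (\<Sum>(c, d)\<in>P. norm (h d - h c)) + (\<Sum>(c, d)\<in>P. norm (k d - k c))"
      by (simp add: split_def sum.distrib)
    also have "\<dots> < e"
      using \<delta>1[of P] \<delta>2[of P] P by simp
    finally show ?thesis .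
  qed
  with \<open>\<delta>1 > 0\<close> \<open>\<delta>2 > 0\<close> show "\<exists>\<delta>>0. \<forall>P. finite P \<and> (\<forall>(c, d)\<in>P. a \<le> c \<and> c \<le> d \<and> d \<le> b) \<and>
      disjoint_family_on (\<lambda>(c, d). {c<..<d}) P \<and> (\<Sum>(c, d)\<in>P. d - c) < \<delta> \<longrightarrow>
      (\<Sum>(c, d)\<in>P. norm (h d - k d - (h c - k c))) < e"
    by (intro exI[of _ "min \<delta>1 \<delta>2"]) auto
qed

lemma abs_cont_on_imp_continuous_on:
  assumes "abs_cont_on h a b"
  shows "continuous_on {a..b} h"
  unfolding continuous_on_iff
proof (intro ballI allI impI)
  fix t e :: real assume t: "t \<in> {a..b}" and "e > 0"
  then obtain \<delta> where "\<delta> > 0" and \<delta>: "\<And>P :: (real \<times> real) set.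
     finite P \<and> (\<forall>(c, d)\<in>P. a \<le> c \<and> c \<le> d \<and> d \<le> b) \<and>
     disjoint_family_on (\<lambda>(c, d). {c<..<d}) P \<and> (\<Sum>(c, d)\<in>P. d - c) < \<delta>
     \<Longrightarrow> (\<Sum>(c, d)\<in>P. norm (h d - h c)) < e"
    using assms unfolding abs_cont_on_def by meson
  \<comment> \<open>One interval is enough for continuity; \<open>min\<close> and \<open>max\<close>
    put its end points in order, whichever side of \<open>t\<close> the point \<open>s\<close> lies
    on.\<close>
  have "dist (h s) (h t) < e" if "s \<in> {a..b}" "dist s t < \<delta>" for s
    using \<delta>[of "{(min s t, max s t)}"] t that
    by (cases s t rule: linorder_cases)
      (auto simp: dist_norm disjoint_family_on_def norm_minus_commute \<open>e > 0\<close>)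
  with \<open>\<delta> > 0\<close> show "\<exists>\<delta>>0. \<forall>s\<in>{a..b}. dist s t < \<delta> \<longrightarrow> dist (h s) (h t) < e"
    by blast
qed

text \<open>Translates the definition from pairs of end points to divisions of a set, with smallness
  measured by Lebesgue measure. This is the form that applies to intervals lying in an open set of
  small measure.\<close>

lemma abs_cont_on_small_division:
  fixes h :: "real \<Rightarrow> 'a::real_normed_vector"
  assumes "abs_cont_on h a b" "\<epsilon> > 0"
  obtains \<delta> where "\<delta> > 0"
    "\<And>\<D> S. \<D> division_of S \<Longrightarrow> S \<subseteq> {a..b} \<Longrightarrow> measure lebesgue S < \<delta> \<Longrightarrow>
      (\<Sum>K\<in>\<D>. norm (h (Sup K) - h (Inf K))) < \<epsilon>"
proof -
  obtain \<delta> where "\<delta> > 0" and \<delta>: "\<And>P :: (real \<times> real) set.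
     finite P \<and> (\<forall>(c, d)\<in>P. a \<le> c \<and> c \<le> d \<and> d \<le> b) \<and>
     disjoint_family_on (\<lambda>(c, d). {c<..<d}) P \<and> (\<Sum>(c, d)\<in>P. d - c) < \<delta>
     \<Longrightarrow> (\<Sum>(c, d)\<in>P. norm (h d - h c)) < \<epsilon>"
    using assms unfolding abs_cont_on_def by meson
  have "(\<Sum>K\<in>\<D>. norm (h (Sup K) - h (Inf K))) < \<epsilon>"
    if \<D>: "\<D> division_of S" and S: "S \<subseteq> {a..b}" "measure lebesgue S < \<delta>" for \<D> S
  proof -
    let ?e = "\<lambda>K::real set. (Inf K, Sup K)"
    have K: "Inf K \<le> Sup K \<and> K = {Inf K..Sup K}" if K: "K \<in> \<D>" for K
    proof -
      obtain c d where "K = cbox c d" "K \<noteq> {}"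
        using division_ofD(3,4)[OF \<D> K] by blast
      then show ?thesis by auto
    qed
    then have Kle: "Inf K \<le> Sup K" if "K \<in> \<D>" for K
      using that by blast
    \<comment> \<open>A member of a division is a nonempty closed interval, so its end points
      determine it, even when it is a single point. Sums over end point pairs can therefore be
      reindexed by the division.\<close>
    have inj: "inj_on ?e \<D>"
    proof (rule inj_onI)
      fix K L assume KL: "K \<in> \<D>" "L \<in> \<D>" and eq: "?e K = ?e L"
      have "K = {Inf K..Sup K}" using K[OF KL(1)] by blast
      also have "\<dots> = {Inf L..Sup L}" using eq by simp
      also have "\<dots> = L" using K[OF KL(2)] by blast
      finally show "K = L" .
    qed
    have bds: "a \<le> Inf K \<and> Sup K \<le> b" if "K \<in> \<D>" for K
    proof -
      have "{Inf K..Sup K} = K"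
        using K[OF that] by blast
      also have "\<dots> \<subseteq> {a..b}"
        using division_ofD(2)[OF \<D> that] S(1) by blast
      finally show ?thesis using Kle[OF that] by simp
    qed
    have disj: "disjoint_family_on (\<lambda>(c, d). {c<..<d}) (?e ` \<D>)"
      unfolding disjoint_family_on_def
    proof (intro ballI impI)
      fix i j assume "i \<in> ?e ` \<D>" "j \<in> ?e ` \<D>" "i \<noteq> j"
      then obtain K L where KL: "K \<in> \<D>" "L \<in> \<D>" "K \<noteq> L" and ij: "i = ?e K" "j = ?e L"
        by blast
      \<comment> \<open>Divisions have disjoint interiors, and these are exactly the open intervals
        of the definition.\<close>
      have int: "interior M = {Inf M<..<Sup M}" if "M \<in> \<D>" for M
        using K[OF that] interior_atLeastAtMost_real[of "Inf M" "Sup M"] by simp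
      show "(case i of (c, d) \<Rightarrow> {c<..<d}) \<inter> (case j of (c, d) \<Rightarrow> {c<..<d}) = {}"
        using division_ofD(5)[OF \<D> KL] int[OF KL(1)] int[OF KL(2)] by (simp add: ij)
    qed
    have "(\<Sum>(c, d)\<in>?e ` \<D>. d - c) = (\<Sum>K\<in>\<D>. measure lebesgue K)"
    proof (subst sum.reindex[OF inj], rule sum.cong)
      fix K assume "K \<in> \<D>"
      then have "measure lebesgue K = measure lebesgue {Inf K..Sup K}" "Inf K \<le> Sup K"
        using K by auto
      then show "((\<lambda>(c, d). d - c) \<circ> ?e) K = measure lebesgue K" by simp
    qed simp
    also have "\<dots> < \<delta>"
      using content_division[OF \<D>] S(2) by simp
    finally have "(\<Sum>(c, d)\<in>?e ` \<D>. norm (h d - h c)) < \<epsilon>"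
      using division_ofD(1)[OF \<D>] Kle bds disj by (intro \<delta>) auto
    then show ?thesis
      by (subst (asm) sum.reindex[OF inj]) simp
  qed
  with \<open>\<delta> > 0\<close> that show ?thesis by blast
qed

section \<open>Monotonicity from the sign of the derivative almost everywhere\<close>

text \<open>Subtract the first-order expansions at \<open>t\<close> of \<open>h d\<close> and
  \<open>h c\<close>: the linear part \<open>(d - c) * m\<close> is nonpositive, and since
  \<open>t\<close> lies between \<open>c\<close> and \<open>d\<close> the two errors add up to at
  most \<open>\<epsilon> * (d - c)\<close>.\<close>

lemma has_vector_derivative_nonpos_straddle:
  fixes h :: "real \<Rightarrow> real"
  assumes "(h has_vector_derivative m) (at t within S)" "m \<le> 0" "\<epsilon> > 0"
  obtains r where "r > 0"
    "\<And>c d. c \<in> S \<Longrightarrow> d \<in> S \<Longrightarrow> c \<le> t \<Longrightarrow> t \<le> d \<Longrightarrow> {c, d} \<subseteq> ball t r \<Longrightarrow> h d - h c \<le> \<epsilon> * (d - c)"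
proof -
  obtain r where "r > 0" and
    r: "\<forall>s\<in>S. norm (s - t) < r \<longrightarrow> norm (h s - h t - (s - t) *\<^sub>R m) \<le> \<epsilon> * norm (s - t)"
    using assms(1,3) unfolding has_vector_derivative_def has_derivative_within_alt by blast
  have "h d - h c \<le> \<epsilon> * (d - c)"
    if "c \<in> S" "d \<in> S" "c \<le> t" "t \<le> d" "{c, d} \<subseteq> ball t r" for c d
  proof -
    have "\<bar>h d - h t - (d - t) * m\<bar> \<le> \<epsilon> * (d - t)" "\<bar>h c - h t - (c - t) * m\<bar> \<le> \<epsilon> * (t - c)"
      using bspec[OF r that(1)] bspec[OF r that(2)] that(3-5) by (auto simp: dist_norm)
    moreover have "(d - c) * m \<le> 0"
      using that assms(2) by (simp add: mult_nonneg_nonpos)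
    ultimately show ?thesis
      by (simp add: algebra_simps abs_le_iff)
  qed
  with \<open>r > 0\<close> that show ?thesis by blast
qed

text \<open>Cover the exceptional set by an open set of small measure and choose a gauge such that intervals
  tagged in the exceptional set stay in the cover, while on the others the straddle estimate holds.
  In a fine tagged division, absolute continuity bounds the contribution of the former.\<close>

lemma abs_cont_on_nonincreasing:
  fixes h :: "real \<Rightarrow> real"
  assumes "abs_cont_on h a b" "a \<le> b"
    and N: "negligible N"
    and deriv: "\<And>t. t \<in> {a..b} - N \<Longrightarrow> \<exists>m\<le>0. (h has_vector_derivative m) (at t within {a..b})"
  shows "h b \<le> h a"
proof -
  \<comment> \<open>The intervals tagged outside \<open>N\<close> contribute at most
    \<open>\<epsilon> * (b - a)\<close>; the summand 1 pays for the further
    \<open>\<epsilon>\<close> from those tagged in \<open>N\<close>.\<close>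
  have main: "h b - h a \<le> \<epsilon> * (b - a + 1)" if "\<epsilon> > 0" for \<epsilon>
  proof -
    obtain \<delta> where "\<delta> > 0" and \<delta>: "\<And>\<D> S. \<D> division_of S \<Longrightarrow> S \<subseteq> {a..b} \<Longrightarrow>
        measure lebesgue S < \<delta> \<Longrightarrow> (\<Sum>K\<in>\<D>. norm (h (Sup K) - h (Inf K))) < \<epsilon>"
      using abs_cont_on_small_division[OF assms(1) \<open>\<epsilon> > 0\<close>] by metis
    have N0: "N \<in> null_sets lebesgue"
      using N by (simp add: negligible_iff_null_sets)
    \<comment> \<open>Outer regularity bounds only \<open>O' - N\<close>; as \<open>N\<close> is a
      null set, the same bound holds for \<open>O'\<close>. The threshold is the one that absolute
      continuity assigns to \<open>\<epsilon>\<close>.\<close>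
    obtain O' where O': "open O'" "N \<subseteq> O'" "O' - N \<in> lmeasurable"
        "emeasure lebesgue (O' - N) < ennreal \<delta>"
      using sets_lebesgue_outer_open[of N \<delta>] N0 \<open>\<delta> > 0\<close> by blast
    have "emeasure lebesgue O' = emeasure lebesgue (O' - N)"
      using O' N0 by (intro emeasure_Diff_null_set[symmetric]) auto
    with O'(4) have em: "emeasure lebesgue O' < ennreal \<delta>"
      by metis
    then have O_lm: "O' \<in> lmeasurable"
      using O'(1) by (intro fmeasurableI) (auto simp: less_top[symmetric] top_unique)
    then have O_small: "measure lebesgue O' < \<delta>"
      using em by (subst (asm) emeasure_eq_measure2) (auto simp: ennreal_less_iff)
    \<comment> \<open>The gauge needs a radius at every real \<open>t\<close>; for \<open>t\<close>
      outside both \<open>N\<close> and \<open>{a..b}\<close> the two conditions are void and any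
      radius will do.\<close>
    have "\<exists>r>0. (t \<in> N \<longrightarrow> ball t r \<subseteq> O') \<and> (t \<in> {a..b} - N \<longrightarrow>
        (\<forall>c\<in>{a..b}. \<forall>d\<in>{a..b}. c \<le> t \<longrightarrow> t \<le> d \<longrightarrow> {c, d} \<subseteq> ball t r \<longrightarrow> h d - h c \<le> \<epsilon> * (d - c)))"
      for t
    proof (cases "t \<in> N")
      case True
      then show ?thesis using O'(1,2) by (auto simp: open_contains_ball)
    next
      case tN: False
      show ?thesis
      proof (cases "t \<in> {a..b}")
        case True
        then obtain m where "m \<le> 0" "(h has_vector_derivative m) (at t within {a..b})"
          using deriv tN by blast
        from has_vector_derivative_nonpos_straddle[OF this(2,1) \<open>\<epsilon> > 0\<close>] show ?thesis
          using tN by metis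
      qed (use tN in \<open>auto intro: exI[of _ 1]\<close>)
    qed
    then obtain r where r: "\<And>t. r t > 0" "\<And>t. t \<in> N \<Longrightarrow> ball t (r t) \<subseteq> O'"
      "\<And>t c d. t \<in> {a..b} - N \<Longrightarrow> c \<in> {a..b} \<Longrightarrow> d \<in> {a..b} \<Longrightarrow> c \<le> t \<Longrightarrow> t \<le> d \<Longrightarrow>
        {c, d} \<subseteq> ball t (r t) \<Longrightarrow> h d - h c \<le> \<epsilon> * (d - c)"
      by metis
    have "gauge (\<lambda>t. ball t (r t))"
      using r(1) by (simp add: gauge_def)
    then obtain p where p: "p tagged_division_of {a..b}" and fine: "(\<lambda>t. ball t (r t)) fine p"
      using fine_division_exists_real by blast
    note pD = tagged_division_ofD[OF p]
    have K: "K = {Inf K..Sup K} \<and> Inf K \<le> t \<and> t \<le> Sup K \<and> Inf K \<in> {a..b} \<and> Sup K \<in> {a..b} \<and>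
        {Inf K, Sup K} \<subseteq> ball t (r t)" if tK: "(t, K) \<in> p" for t K
    proof -
      obtain c d where cd: "K = {c..d}"
        using pD(4)[OF tK] by auto
      have in_K: "t \<in> K" "K \<subseteq> {a..b}" "K \<subseteq> ball t (r t)"
        using pD(2,3)[OF tK] fineD[OF fine tK] by auto
      with cd have ends: "c \<in> K" "d \<in> K" "Inf K = c" "Sup K = d"
        by auto
      have "c \<in> {a..b} \<and> d \<in> {a..b} \<and> {c, d} \<subseteq> ball t (r t)"
        using in_K(2,3) ends(1,2) by blast
      moreover have "c \<le> t" "t \<le> d"
        using in_K(1) cd by auto
      ultimately show ?thesis unfolding ends using cd by blast
    qed
    define q where "q = {(t, K) \<in> p. t \<in> N}"
    have qp: "q \<subseteq> p" by (auto simp: q_def)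
    have part: "q tagged_partial_division_of {a..b}"
      using p qp unfolding tagged_division_of_def by (blast intro: tagged_partial_division_subset)
    \<comment> \<open>The absolute continuity estimate is about untagged divisions, so the tags of
      \<open>q\<close> are dropped.\<close>
    have div: "(snd ` q) division_of \<Union>(snd ` q)"
      by (rule partial_division_of_tagged_division[OF part])
    have sub: "\<Union>(snd ` q) \<subseteq> O'" "\<Union>(snd ` q) \<subseteq> {a..b}"
      using fineD[OF fine] r(2) pD(3) by (fastforce simp: q_def)+
    have "measure lebesgue (\<Union>(snd ` q)) \<le> measure lebesgue O'"
      using sub(1) O_lm lmeasurable_division[OF div] by (intro measure_mono_fmeasurable) auto
    then have "(\<Sum>K\<in>snd ` q. norm (h (Sup K) - h (Inf K))) < \<epsilon>"
      using O_small sub(2) by (intro \<delta>[OF div]) auto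
    \<comment> \<open>An interval can carry several tags only if it is degenerate, and then its
      increment is 0, so dropping the tags does not change the sum.\<close>
    moreover have "(\<Sum>(t, K)\<in>q. norm (h (Sup K) - h (Inf K))) =
        (\<Sum>K\<in>snd ` q. norm (h (Sup K) - h (Inf K)))"
    proof -
      \<comment> \<open>The lemma on sums over tagged divisions also wants value 0 at the empty set, where \<open>Sup\<close>
        and \<open>Inf\<close> are unspecified.\<close>
      let ?d = "\<lambda>K. if K = {} then 0 else norm (h (Sup K) - h (Inf K))"
      have ne: "K \<noteq> {}" if "(t, K) \<in> q" for t K
        using that qp pD(2) by blast
      then have "(\<Sum>(t, K)\<in>q. norm (h (Sup K) - h (Inf K))) = (\<Sum>(t, K)\<in>q. ?d K)"
        by (intro sum.cong) auto
      also have "\<dots> = (\<Sum>K\<in>snd ` q. ?d K)"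
        by (rule sum.over_tagged_division_lemma[OF tagged_partial_division_of_Union_self[OF part]])
          auto
      also have "\<dots> = (\<Sum>K\<in>snd ` q. norm (h (Sup K) - h (Inf K)))"
        using ne by (intro sum.cong) auto
      finally show ?thesis .
    qed
    moreover have "(\<Sum>(t, K)\<in>q. h (Sup K) - h (Inf K)) \<le> (\<Sum>(t, K)\<in>q. norm (h (Sup K) - h (Inf K)))"
      by (intro sum_mono) auto
    moreover have "(\<Sum>(t, K)\<in>p - q. h (Sup K) - h (Inf K)) \<le> (\<Sum>(t, K)\<in>p - q. \<epsilon> * (Sup K - Inf K))"
    proof (intro sum_mono, clarify)
      fix t K assume tK: "(t, K) \<in> p" "(t, K) \<notin> q"
      then have "t \<in> {a..b} - N"
        using pD(2,3)[OF tK(1)] by (auto simp: q_def)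
      then show "h (Sup K) - h (Inf K) \<le> \<epsilon> * (Sup K - Inf K)"
        using K[OF tK(1)] by (intro r(3)[of t]) auto
    qed
    moreover have "(\<Sum>(t, K)\<in>p - q. \<epsilon> * (Sup K - Inf K)) \<le> (\<Sum>(t, K)\<in>p. \<epsilon> * (Sup K - Inf K))"
    proof (rule sum_mono2[OF pD(1)])
      fix w assume "w \<in> p - (p - q)"
      then show "0 \<le> (case w of (t, K) \<Rightarrow> \<epsilon> * (Sup K - Inf K))"
        using K \<open>\<epsilon> > 0\<close> by (cases w) fastforce
    qed auto
    \<comment> \<open>The lengths telescope as the increments of the linear function
      \<open>\<lambda>t. \<epsilon> * t\<close>.\<close>
    moreover have "(\<Sum>(t, K)\<in>p. \<epsilon> * (Sup K - Inf K)) = \<epsilon> * (b - a)"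
      using additive_tagged_division_1[OF \<open>a \<le> b\<close> p, of "\<lambda>t. \<epsilon> * t"] by (simp add: algebra_simps)
    moreover have "(\<Sum>(t, K)\<in>p. h (Sup K) - h (Inf K)) = h b - h a"
      by (rule additive_tagged_division_1[OF \<open>a \<le> b\<close> p])
    moreover have "(\<Sum>(t, K)\<in>p. h (Sup K) - h (Inf K)) =
        (\<Sum>(t, K)\<in>p - q. h (Sup K) - h (Inf K)) + (\<Sum>(t, K)\<in>q. h (Sup K) - h (Inf K))"
      by (rule sum.subset_diff[OF qp pD(1)])
    ultimately show ?thesis by (simp add: algebra_simps)
  qed
  \<comment> \<open>The divisor \<open>b - a + 1\<close> is positive even when
    \<open>a = b\<close>.\<close>
  have "h b - h a \<le> 0 + e" if "e > 0" for e
    using main[of "e / (b - a + 1)"] that \<open>a \<le> b\<close> by simp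
  then show ?thesis
    using field_le_epsilon[of "h b - h a" 0] by simp
qed

text \<open>Start at the last time before \<open>t\<close> at which \<open>k\<close> is nonpositive: from there
  on \<open>k\<close> cannot increase.\<close>

lemma abs_cont_on_nonpos:
  fixes k :: "real \<Rightarrow> real"
  assumes k: "abs_cont_on k a b" and "k a \<le> 0"
    and deriv: "AE t in lebesgue_on {a..b}. k t > 0 \<longrightarrow>
      (\<exists>m\<le>0. (k has_vector_derivative m) (at t within {a..b}))"
    and t: "t \<in> {a..b}"
  shows "k t \<le> 0"
proof -
  have "AE t in lebesgue. t \<in> {a..b} \<longrightarrow> k t > 0 \<longrightarrow>
      (\<exists>m\<le>0. (k has_vector_derivative m) (at t within {a..b}))"
    using deriv by (subst (asm) AE_restrict_space_iff) auto
  then obtain N where N: "N \<in> null_sets lebesgue"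
    "{t. \<not> (t \<in> {a..b} \<longrightarrow> k t > 0 \<longrightarrow>
      (\<exists>m\<le>0. (k has_vector_derivative m) (at t within {a..b})))} \<subseteq> N"
    by (auto simp: eventually_ae_filter)
  define S where "S = {s \<in> {a..t}. k s \<le> 0}"
  have "continuous_on {a..t} k"
    using abs_cont_on_imp_continuous_on[OF k] by (rule continuous_on_subset) (use t in auto)
  then have "closed ({a..t} \<inter> k -` {..0})"
    by (rule continuous_closed_preimage) auto
  also have "{a..t} \<inter> k -` {..0} = S"
    by (auto simp: S_def)
  finally have "closed S" .
  \<comment> \<open>Being closed, nonempty and bounded above, \<open>S\<close> contains its
    supremum, so a last time in \<open>S\<close> exists.\<close>
  moreover have "a \<in> S" "bdd_above S"
    using t \<open>k a \<le> 0\<close> by (auto simp: S_def)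
  ultimately have s: "Sup S \<in> S"
    using closed_contains_Sup by blast
  define s where "s = Sup S"
  have pos: "k r > 0" if "s < r" "r \<le> t" for r
  proof (rule ccontr)
    assume "\<not> k r > 0"
    then have "r \<in> S" using that s by (auto simp: S_def s_def)
    then show False using cSup_upper[OF _ \<open>bdd_above S\<close>, of r] that by (simp add: s_def)
  qed
  have "k t \<le> k s"
  \<comment> \<open>At \<open>s\<close> itself \<open>k\<close> is nonpositive and the hypothesis on
    derivatives says nothing, so this one point joins the exceptional set.\<close>
  proof (rule abs_cont_on_nonincreasing[of k s t "insert s N"])
    show "abs_cont_on k s t"
      using k s t by (auto intro: abs_cont_on_subinterval simp: S_def s_def)
    show "s \<le> t" using s by (auto simp: S_def s_def)
    show "negligible (insert s N)"
      using N(1) by (simp add: negligible_iff_null_sets)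
    fix r assume r: "r \<in> {s..t} - insert s N"
    then have "r \<in> {a..b}" "k r > 0" "r \<notin> N" using s t pos[of r] by (auto simp: S_def s_def)
    then obtain m where "m \<le> 0" "(k has_vector_derivative m) (at r within {a..b})"
      using N(2) by blast
    moreover have "{s..t} \<subseteq> {a..b}" using s t by (auto simp: S_def s_def)
    ultimately show "\<exists>m\<le>0. (k has_vector_derivative m) (at r within {s..t})"
      by (blast intro: has_vector_derivative_within_subset)
  qed
  with s show ?thesis by (auto simp: S_def s_def)
qed

section \<open>Comparison of the two constraints\<close>

lemma state_imp_mixed_constraint:
  assumes "v \<in> controls T {0..1}" "state_constraint T y z"
  shows "mixed_constraint T v y z"
  unfolding mixed_constraint_def
proof (rule AE_I2)
  fix t assume "t \<in> space (lebesgue_on {0..T})"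
  then have "t \<in> {0..T}" by simp
  then have "z t - y t \<ge> 0" using assms(2) unfolding state_constraint_def by blast
  then show "0 \<le> max (y t - z t) 0 * (1 - v t) + z t - y t" by simp
qed

lemma mixed_imp_state_constraint:
  assumes v: "v \<in> controls T {0..1}" and sol: "extended_solution D f g T x0 y0 u v x y z"
    and mixed: "mixed_constraint T v y z"
  shows "state_constraint T y z"
  unfolding state_constraint_def
proof
  fix t assume t: "t \<in> {0..T}"
  have "y t - z t \<le> 0"
  proof (rule abs_cont_on_nonpos[OF _ _ _ t])
    show "abs_cont_on (\<lambda>t. y t - z t) 0 T" "y 0 - z 0 \<le> 0"
      using sol by (auto simp: extended_solution_def xy_dynamics_def intro: abs_cont_on_diff)
    have "AE t in lebesgue_on {0..T}. (y has_vector_derivative g ((x t, y t), u t)) (at t within {0..T})"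
      "AE t in lebesgue_on {0..T}.
        (z has_vector_derivative max (g ((x t, y t), u t)) 0 * (1 - v t)) (at t within {0..T})"
      using sol by (auto simp: extended_solution_def xy_dynamics_def)
    \<comment> \<open>\<open>AE_space\<close> supplies \<open>t \<in> {0..T}\<close>, the range on
      which the control \<open>v\<close> is known to be nonnegative.\<close>
    with mixed[unfolded mixed_constraint_def] AE_space
    show "AE t in lebesgue_on {0..T}. 0 < y t - z t \<longrightarrow>
      (\<exists>m\<le>0. ((\<lambda>t. y t - z t) has_vector_derivative m) (at t within {0..T}))"
    proof eventually_elim
      case (elim t)
      show ?case
      proof
        assume yz: "0 < y t - z t"
        then have "(y t - z t) * v t \<le> 0"
          using elim(1) by (simp add: algebra_simps max_def)
        moreover have "v t \<ge> 0" using v elim(2) by (auto simp: controls_def)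
        ultimately have "v t = 0" using yz by (simp add: mult_le_0_iff)
        then have "g ((x t, y t), u t) - max (g ((x t, y t), u t)) 0 * (1 - v t) \<le> 0" by simp
        with has_vector_derivative_diff[OF elim(3,4)]
        show "\<exists>m\<le>0. ((\<lambda>t. y t - z t) has_vector_derivative m) (at t within {0..T})" by blast
      qed
    qed
  qed
  then show "0 \<le> z t - y t" by simp
qed

theorem proposition3p3:
  fixes D :: "((real^'n) \<times> real) set"
    and U :: "(real^'p) set"
    and f :: "((real^'n) \<times> real) \<times> (real^'p) \<Rightarrow> real^'n"
    and g :: "((real^'n) \<times> real) \<times> (real^'p) \<Rightarrow> real"
    and T y0 :: real
    and x0 :: "real^'n"
  assumes "open D" and "connected D"
    and "invariant_domain D U f g"
    and "compact U"
    and "C1_on f (D \<times> U)" and "C1_on g (D \<times> U)"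
    and "linear_growth D U f g"
    and "T > 0"
    and "(x0, y0) \<in> D"
  shows "equivalent_problems (problem1 D U f g T x0 y0) (problem2 D U f g T x0 y0)"
proof -
  \<comment> \<open>The costs agree by definition and the feasible sets differ only in the
    constraint, so the records are equal and all clauses of equivalence follow at once.\<close>
  have "problem1 D U f g T x0 y0 = problem2 D U f g T x0 y0"
    unfolding problem1_def problem2_def
    using state_imp_mixed_constraint mixed_imp_state_constraint by fastforce
  then show ?thesis by (simp add: equivalent_problems_def)
qed

end
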